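(* Let $V$ and $V'$ be left vector spaces over division rings $R$ and $R'$, respectively, with $\dim V=n$ finite and $n\ge 3$. Let $g:V\to V'$ be a non-trivial GL-mapping, and let $V_g$ be the subspace of $V'$ spanned by $g(V)$. If $\dim V_g\le n$, then $g$ is a strong semilinear embedding.
   Context: A mapping $g:V\to V'$ (not assumed additive or linear in any sense) is a GL-mapping if for every $u\in \mathrm{GL}(V)$ there is $u'\in \mathrm{GL}(V')$ such that $gu=u'g$. Here $\mathrm{GL}(W)$ is the group of linear automorphisms of $W$. A GL-mapping $g:V\to V'$ is non-trivial if its restriction to $V\setminus\{0\}$ is non-constant. A mapping $l:V\to V'$ is semilinear if $l(x+y)=l(x)+l(y)$ for all $x,y\in V$ and there is a ring homomorphism $\sigma:R\to R'$ such that $l(ax)=\sigma(a)l(x)$ for all $a\in R$, $x\in V$ ($\sigma$ need not be surjective). A strong semilinear embedding is a semilinear injection $l:V\to V'$ which transfers any $n=\dim V$ linearly independent vectors of $V$ to linearly independent vectors of $V'$. *)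

theory Defs
  imports Complex_Main
begin

text \<open>
  The locales \<^locale>\<open>module\<close> and \<^locale>\<open>vector_space\<close> require commutative scalars, so
  left vector spaces over division rings are set up here along the same lines: the space is
  the whole type \<open>'v\<close>, and span, independence and dimension are defined literally
  as there.
\<close>

locale left_vector_space =
  fixes scale :: "'r::division_ring \<Rightarrow> 'v::ab_group_add \<Rightarrow> 'v" (infixr \<open>*s\<close> 75)
  assumes scale_right_distrib: "a *s (x + y) = a *s x + a *s y"
    and scale_left_distrib: "(a + b) *s x = a *s x + b *s x"
    and scale_scale: "a *s (b *s x) = (a * b) *s x"
    and scale_one: "1 *s x = x"
begin

definition span :: "'v set \<Rightarrow> 'v set"
  where "span S = {(\<Sum>v\<in>t. c v *s v) | t c. finite t \<and> t \<subseteq> S}"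

definition dependent :: "'v set \<Rightarrow> bool"
  where "dependent S \<longleftrightarrow>
    (\<exists>t c. finite t \<and> t \<subseteq> S \<and> (\<Sum>v\<in>t. c v *s v) = 0 \<and> (\<exists>v\<in>t. c v \<noteq> 0))"

abbreviation independent :: "'v set \<Rightarrow> bool"
  where "independent S \<equiv> \<not> dependent S"

text \<open>
  Both notions refer to the subspace spanned by \<open>S\<close>. As for any use of \<^const>\<open>card\<close>,
  \<open>dim\<close> is meaningful only together with \<open>finite_dim\<close>.
\<close>

definition finite_dim :: "'v set \<Rightarrow> bool"
  where "finite_dim S \<longleftrightarrow> (\<exists>B. finite B \<and> independent B \<and> span B = span S)"

definition dim :: "'v set \<Rightarrow> nat"
  where "dim S =
    (if \<exists>B. independent B \<and> span B = span S
     then card (SOME B. independent B \<and> span B = span S) else 0)"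

definition GL :: "('v \<Rightarrow> 'v) set"
  where "GL = {u. bij u \<and> (\<forall>x y. u (x + y) = u x + u y) \<and> (\<forall>a x. u (a *s x) = a *s u x)}"

end

definition ring_homomorphism :: "('r::ring_1 \<Rightarrow> 's::ring_1) \<Rightarrow> bool"
  where "ring_homomorphism \<sigma> \<longleftrightarrow>
    \<sigma> 1 = 1 \<and> (\<forall>a b. \<sigma> (a + b) = \<sigma> a + \<sigma> b) \<and> (\<forall>a b. \<sigma> (a * b) = \<sigma> a * \<sigma> b)"

definition nontrivial :: "('v::zero \<Rightarrow> 'w) \<Rightarrow> bool"
  where "nontrivial g \<longleftrightarrow> \<not> (\<exists>c. \<forall>x\<in>UNIV - {0}. g x = c)"

locale left_vector_space_pair =
  V: left_vector_space scale + V': left_vector_space scale'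
  for scale :: "'r::division_ring \<Rightarrow> 'v::ab_group_add \<Rightarrow> 'v"
    and scale' :: "'s::division_ring \<Rightarrow> 'w::ab_group_add \<Rightarrow> 'w"
begin

definition GL_mapping :: "('v \<Rightarrow> 'w) \<Rightarrow> bool"
  where "GL_mapping g \<longleftrightarrow> (\<forall>u\<in>V.GL. \<exists>u'\<in>V'.GL. g \<circ> u = u' \<circ> g)"

definition semilinear :: "('v \<Rightarrow> 'w) \<Rightarrow> bool"
  where "semilinear l \<longleftrightarrow>
    (\<forall>x y. l (x + y) = l x + l y) \<and>
    (\<exists>\<sigma>. ring_homomorphism \<sigma> \<and> (\<forall>a x. l (scale a x) = scale' (\<sigma> a) (l x)))"

text \<open>
  Since \<open>l\<close> is injective, stating preservation of independence for sets rather than for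
  indexed families loses nothing.
\<close>

definition strong_semilinear_embedding :: "('v \<Rightarrow> 'w) \<Rightarrow> bool"
  where "strong_semilinear_embedding l \<longleftrightarrow>
    semilinear l \<and> inj l \<and>
    (\<forall>B. finite B \<and> card B = V.dim UNIV \<and> V.independent B \<longrightarrow> V'.independent (l ` B))"

end

end

theory Submission
  imports Defs
begin

text \<open>
  Say that \<open>u \<in> GL(V)\<close> and \<open>u' \<in> GL(V')\<close> are companions when \<open>g \<circ> u = u' \<circ> g\<close>. Since \<open>GL(V)\<close> is
  transitive on pairs of independent vectors, any relation between the \<open>g\<close>-values of one such
  pair can be carried to every other pair by a companion.

  In particular, if \<open>g\<close> took equal values on one independent pair, it would do so on all of them
  and hence be constant off zero; so \<open>g\<close> separates independent vectors (\<open>separates_lines\<close>).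
  This is what makes transvections useful. Suppose \<open>w\<close> is a combination of the \<open>g\<close>-values of a
  basis \<open>B\<close>, and let \<open>u\<close> add another basis vector \<open>b'\<close> to \<open>b\<close> and fix the rest of \<open>B\<close>. If the
  companion of \<open>u\<close> fixes \<open>w\<close>, comparing the two expansions leaves \<open>c b (g (b + b') - g b) = 0\<close>,
  so the coefficient at \<open>b\<close> vanishes (\<open>coefficient_vanishes\<close>). For \<open>w = 0\<close> this says that \<open>g\<close>
  maps bases to independent sets (\<open>basis_image\<close>).

  The bound on the dimension now forces \<open>g(B)\<close> to span \<open>V\<^sub>g\<close>. Thus every \<open>g v\<close> has such an
  expansion, and a vector \<open>v\<close> in the span of \<open>S \<subseteq> B\<close> is fixed by the transvections that move
  only some \<open>b \<in> B - S\<close>; hence \<open>g v\<close> lies in the span of \<open>g(S)\<close> (\<open>span_image\<close>). The cases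
  \<open>S = {}\<close>, \<open>{x}\<close>, \<open>{x, y}\<close> give \<open>g 0 = 0\<close>, \<open>g (a x) = \<sigma>(a) g x\<close>, and
  \<open>g (x + y) = \<alpha> g x + \<beta> g y\<close> for independent \<open>x, y\<close>, with scalars that are independent of the vectors
  by transitivity. Exchanging \<open>x\<close> and \<open>y\<close> gives \<open>\<alpha> = \<beta>\<close>, and expanding \<open>g (x + y + z)\<close> in two ways
  for three independent vectors gives \<open>\<alpha>\<^sup>2 = \<alpha>\<close>, so \<open>\<alpha> = 1\<close>; this is where \<open>n \<ge> 3\<close> enters.
  Additivity on dependent pairs follows by adding a vector outside their line.
\<close>

section \<open>Linear algebra over a division ring\<close>

context left_vector_space
begin

lemma scale_zero_left [simp]: "0 *s x = 0"
  using scale_left_distrib[of 0 0 x] by simp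

lemma scale_zero_right [simp]: "a *s 0 = 0"
  using scale_right_distrib[of a 0 0] by simp

lemma scale_minus_left [simp]: "(- a) *s x = - (a *s x)"
  using scale_left_distrib[of a "- a" x] by (simp add: add_eq_0_iff)

lemma scale_minus_right [simp]: "a *s (- x) = - (a *s x)"
  using scale_right_distrib[of a x "- x"] by (simp add: add_eq_0_iff)

lemma scale_diff_left: "(a - b) *s x = a *s x - b *s x"
  using scale_left_distrib[of a "- b" x] by simp

lemma scale_diff_right: "a *s (x - y) = a *s x - a *s y"
  using scale_right_distrib[of a x "- y"] by simp

lemma scale_sum_right: "a *s sum f A = (\<Sum>i\<in>A. a *s f i)"
  by (induction A rule: infinite_finite_induct) (auto simp: scale_right_distrib)

lemma scale_inverse: "a \<noteq> 0 \<Longrightarrow> inverse a *s (a *s x) = x"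
  by (simp add: scale_scale scale_one)

lemma scale_eq_0_iff [simp]: "a *s x = 0 \<longleftrightarrow> a = 0 \<or> x = 0"
proof
  assume "a *s x = 0"
  then show "a = 0 \<or> x = 0" using scale_inverse[of a x] by (cases "a = 0") auto
qed auto

definition subspace :: "'v set \<Rightarrow> bool"
  where "subspace T \<longleftrightarrow> 0 \<in> T \<and> (\<forall>x\<in>T. \<forall>y\<in>T. x + y \<in> T) \<and> (\<forall>a. \<forall>x\<in>T. a *s x \<in> T)"

lemma subspace_sum: "subspace T \<Longrightarrow> (\<And>i. i \<in> A \<Longrightarrow> f i \<in> T) \<Longrightarrow> sum f A \<in> T"
  by (induction A rule: infinite_finite_induct) (auto simp: subspace_def)

lemma sum_extend:
  assumes "finite S" "t \<subseteq> S"
  shows "(\<Sum>v\<in>t. c v *s v) = (\<Sum>v\<in>S. (if v \<in> t then c v else 0) *s v)"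
proof -
  have "(\<Sum>v\<in>S. (if v \<in> t then c v else 0) *s v) = (\<Sum>v\<in>t. (if v \<in> t then c v else 0) *s v)"
    using assms by (intro sum.mono_neutral_right) auto
  then show ?thesis by simp
qed

lemma span_finite:
  assumes "finite S" shows "span S = range (\<lambda>c. \<Sum>v\<in>S. c v *s v)"
proof (intro equalityI subsetI)
  fix x assume "x \<in> span S"
  then obtain t c where "finite t" "t \<subseteq> S" "x = (\<Sum>v\<in>t. c v *s v)"
    unfolding span_def by auto
  then have "x = (\<Sum>v\<in>S. (if v \<in> t then c v else 0) *s v)"
    using sum_extend[OF assms, of t c] by simp
  then show "x \<in> range (\<lambda>c. \<Sum>v\<in>S. c v *s v)"
    by (rule range_eqI[where x = "\<lambda>v. if v \<in> t then c v else 0"])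
next
  fix x assume "x \<in> range (\<lambda>c. \<Sum>v\<in>S. c v *s v)"
  then show "x \<in> span S" unfolding span_def using assms by blast
qed

lemma independent_finite:
  assumes "finite S"
  shows "independent S \<longleftrightarrow> (\<forall>c. (\<Sum>v\<in>S. c v *s v) = 0 \<longrightarrow> (\<forall>v\<in>S. c v = 0))"
proof
  assume "independent S"
  then show "\<forall>c. (\<Sum>v\<in>S. c v *s v) = 0 \<longrightarrow> (\<forall>v\<in>S. c v = 0)"
    using assms unfolding dependent_def by blast
next
  assume *: "\<forall>c. (\<Sum>v\<in>S. c v *s v) = 0 \<longrightarrow> (\<forall>v\<in>S. c v = 0)"
  show "independent S"
    unfolding dependent_def
  proof clarify
    fix t c v assume t: "t \<subseteq> S" "(\<Sum>v\<in>t. c v *s v) = 0" "v \<in> t" "c v \<noteq> 0"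
    then have "(\<Sum>v\<in>S. (if v \<in> t then c v else 0) *s v) = 0"
      using sum_extend[OF assms, of t c] by simp
    with *[THEN spec, of "\<lambda>v. if v \<in> t then c v else 0"]
    have "\<forall>v\<in>S. (if v \<in> t then c v else 0) = 0" by simp
    moreover have "v \<in> S" using t by blast
    ultimately show False using t by force
  qed
qed

lemma independent_mono: "independent S \<Longrightarrow> T \<subseteq> S \<Longrightarrow> independent T"
  unfolding dependent_def by blast

lemma independent_unique:
  assumes "finite S" "independent S" "(\<Sum>v\<in>S. c v *s v) = (\<Sum>v\<in>S. d v *s v)" "v \<in> S"
  shows "c v = d v"
proof -
  have "(\<Sum>v\<in>S. (c v - d v) *s v) = 0"
    using assms(3) by (simp add: scale_diff_left sum_subtractf)
  then show ?thesis using assms independent_finite by fastforce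
qed

lemma subspace_span: "subspace (span S)"
  unfolding subspace_def
proof (intro conjI ballI allI)
  show "0 \<in> span S" unfolding span_def by (force intro: exI[of _ "{}"])
next
  fix x y assume "x \<in> span S" "y \<in> span S"
  then obtain t c t' c' where t: "finite t" "t \<subseteq> S" "x = (\<Sum>v\<in>t. c v *s v)"
    "finite t'" "t' \<subseteq> S" "y = (\<Sum>v\<in>t'. c' v *s v)"
    unfolding span_def by auto
  define d where "d v = (if v \<in> t then c v else 0) + (if v \<in> t' then c' v else 0)" for v
  have "x + y = (\<Sum>v\<in>t \<union> t'. d v *s v)"
    using t sum_extend[of "t \<union> t'" t c] sum_extend[of "t \<union> t'" t' c']
    by (simp add: d_def scale_left_distrib sum.distrib)
  moreover have "finite (t \<union> t')" "t \<union> t' \<subseteq> S" using t by auto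
  ultimately show "x + y \<in> span S" unfolding span_def by blast
next
  fix a x assume "x \<in> span S"
  then obtain t c where t: "finite t" "t \<subseteq> S" "x = (\<Sum>v\<in>t. c v *s v)"
    unfolding span_def by auto
  then have "a *s x = (\<Sum>v\<in>t. (a * c v) *s v)" by (simp add: scale_sum_right scale_scale)
  with t show "a *s x \<in> span S"
    unfolding span_def by (intro CollectI exI[of _ t] exI[of _ "\<lambda>v. a * c v"]) simp
qed

lemma span_zero: "0 \<in> span S"
  and span_add: "x \<in> span S \<Longrightarrow> y \<in> span S \<Longrightarrow> x + y \<in> span S"
  and span_scale: "x \<in> span S \<Longrightarrow> a *s x \<in> span S"
  using subspace_span[of S] by (auto simp: subspace_def)

lemma span_diff: "x \<in> span S \<Longrightarrow> y \<in> span S \<Longrightarrow> x - y \<in> span S"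
  using span_add[of x S "- y"] span_scale[of y S "- 1"] by (simp add: scale_one)

lemma span_base: "x \<in> S \<Longrightarrow> x \<in> span S"
  unfolding span_def by (force intro: exI[of _ "{x}"] exI[of _ "\<lambda>_. 1"] simp: scale_one)

lemma span_minimal: "S \<subseteq> T \<Longrightarrow> subspace T \<Longrightarrow> span S \<subseteq> T"
  unfolding span_def by (auto intro!: subspace_sum simp: subspace_def)

lemma span_mono: "S \<subseteq> T \<Longrightarrow> span S \<subseteq> span T"
  unfolding span_def by blast

lemma span_subset_span: "S \<subseteq> span T \<Longrightarrow> span S \<subseteq> span T"
  using span_minimal subspace_span by blast

lemma independent_not_in_span:
  assumes "independent S" "x \<in> S"
  shows "x \<notin> span (S - {x})"
proof
  assume "x \<in> span (S - {x})"
  then obtain t c where t: "finite t" "t \<subseteq> S - {x}" "x = (\<Sum>v\<in>t. c v *s v)"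
    unfolding span_def by auto
  define d where "d = c(x := - 1)"
  have "x \<notin> t" using t by auto
  then have "(\<Sum>v\<in>t. d v *s v) = (\<Sum>v\<in>t. c v *s v)"
    by (intro sum.cong) (auto simp: d_def)
  with t \<open>x \<notin> t\<close> have "(\<Sum>v\<in>insert x t. d v *s v) = 0"
    by (simp add: d_def scale_one)
  moreover have "finite (insert x t)" "insert x t \<subseteq> S" "d x \<noteq> 0" using t assms by (auto simp: d_def)
  ultimately show False using assms(1) unfolding dependent_def by blast
qed

lemma independent_insert:
  assumes "independent S" "x \<notin> span S"
  shows "independent (insert x S)"
  unfolding dependent_def
proof clarify
  fix t c v
  assume t: "finite t" "t \<subseteq> insert x S" "(\<Sum>v\<in>t. c v *s v) = 0" and v: "v \<in> t" "c v \<noteq> 0"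
  show False
  proof (cases "x \<in> t \<and> c x \<noteq> 0")
    case True
    then have "c x *s x + (\<Sum>v\<in>t - {x}. c v *s v) = 0"
      using t sum.remove[of t x "\<lambda>v. c v *s v"] by simp
    then have "c x *s x = (\<Sum>v\<in>t - {x}. (- c v) *s v)"
      by (simp add: sum_negf eq_neg_iff_add_eq_0)
    also have "\<dots> \<in> span S"
      using t(2) by (intro subspace_sum[OF subspace_span] span_scale span_base) auto
    finally have "inverse (c x) *s (c x *s x) \<in> span S" by (rule span_scale)
    then show False using True assms by (simp add: scale_inverse)
  next
    case False
    then have "(\<Sum>v\<in>t - {x}. c v *s v) = 0"
      using t by (cases "x \<in> t") (auto simp: sum.remove)
    moreover have "finite (t - {x})" "t - {x} \<subseteq> S" "v \<in> t - {x}" using False t v by auto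
    ultimately show False using assms(1) v unfolding dependent_def by blast
  qed
qed

text \<open>
  The Steinitz exchange. Keeping \<open>S\<close> inside the new spanning set yields both the bound on
  independent sets and the extension of independent sets to bases.
\<close>
lemma exchange:
  assumes "finite S" "finite T" "independent S" "S \<subseteq> span T"
  shows "\<exists>T'. finite T' \<and> card T' = card T \<and> S \<subseteq> T' \<and> span T \<subseteq> span T'"
  using assms
proof (induction S)
  case empty
  then show ?case by blast
next
  case (insert x S)
  have "independent S" using insert.prems independent_mono by blast
  then obtain T' where T': "finite T'" "card T' = card T" "S \<subseteq> T'" "span T \<subseteq> span T'"
    using insert by blast
  show ?case
  proof (cases "x \<in> T'")
    case True
    with T' show ?thesis by blast
  next
    case False
    have "x \<in> span T'" using insert.prems T' by blast
    then obtain c where c: "x = (\<Sum>v\<in>T'. c v *s v)" using span_finite T' by blast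
    have "x \<notin> span S"
      using independent_not_in_span[of "insert x S" x] insert by simp
    \<comment> \<open>A vector of \<open>T'\<close> that may be replaced by \<open>x\<close>: it occurs in \<open>x\<close> and is not yet in \<open>S\<close>.\<close>
    have "\<exists>y\<in>T' - S. c y \<noteq> 0"
    proof (rule ccontr)
      assume "\<not> ?thesis"
      then have "x = (\<Sum>v\<in>S. c v *s v)"
        using c T' by (metis (no_types, lifting) scale_zero_left sum.mono_neutral_right)
      then show False using \<open>x \<notin> span S\<close> \<open>finite S\<close> span_finite by blast
    qed
    then obtain y where y: "y \<in> T'" "y \<notin> S" "c y \<noteq> 0" by blast
    let ?U = "insert x (T' - {y})"
    have "c y *s y = x - (\<Sum>v\<in>T' - {y}. c v *s v)"
      using c T' y by (simp add: sum.remove)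
    also have "\<dots> \<in> span ?U"
      by (intro span_diff subspace_sum[OF subspace_span]) (auto intro: span_scale span_base)
    finally have "inverse (c y) *s (c y *s y) \<in> span ?U" by (rule span_scale)
    then have "y \<in> span ?U" using y by (simp add: scale_inverse)
    then have "T' \<subseteq> span ?U" by (auto intro: span_base)
    then have "span T \<subseteq> span ?U" using T' span_subset_span by blast
    moreover have "card ?U = card T"
      using T' y False by (metis card.remove card_insert_disjoint Diff_iff finite_Diff)
    ultimately show ?thesis using T' y by (intro exI[of _ ?U]) auto
  qed
qed

lemma independent_card_le:
  assumes "finite T" "independent S" "S \<subseteq> span T"
  shows "finite S \<and> card S \<le> card T"
proof -
  have fin: "card S' \<le> card T" if "finite S'" "S' \<subseteq> S" for S'
  proof -
    have "independent S'" "S' \<subseteq> span T" using that assms independent_mono by auto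
    with exchange[of S' T] that assms show ?thesis by (metis card_mono)
  qed
  moreover have "finite S"
  proof (rule ccontr)
    assume "infinite S"
    then obtain S' where "S' \<subseteq> S" "finite S'" "card S' = Suc (card T)"
      using infinite_arbitrarily_large by blast
    with fin show False by fastforce
  qed
  ultimately show ?thesis by blast
qed

lemma independent_spans_if_card_ge:
  assumes "finite T" "independent S" "S \<subseteq> span T" "card T \<le> card S"
  shows "span S = span T"
proof -
  have "finite S" using independent_card_le assms by blast
  then obtain T' where T': "finite T'" "card T' = card T" "S \<subseteq> T'" "span T \<subseteq> span T'"
    using exchange assms by metis
  then have "T' = S" using assms(4) by (metis card_seteq)
  with T' show ?thesis using assms span_subset_span by blast
qed

text \<open>
  \<open>finite_dim\<close> provides some finite basis, while \<open>dim\<close> counts an arbitrarily chosen one; the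
  exchange property shows that the chosen one is finite too, so that \<open>dim\<close> is not a junk value.
\<close>
lemma finite_dim_obtain_basis:
  assumes "finite_dim S"
  obtains B where "finite B" "independent B" "span B = span S" "card B = dim S"
proof -
  obtain B0 where B0: "finite B0" "independent B0" "span B0 = span S"
    using assms unfolding finite_dim_def by blast
  define B where "B = (SOME B. independent B \<and> span B = span S)"
  have B: "independent B \<and> span B = span S"
    unfolding B_def by (rule someI[of _ B0]) (use B0 in blast)
  have "B \<subseteq> span B0" using B B0 span_base by auto
  then have "finite B" using independent_card_le B B0 by blast
  moreover have "card B = dim S" unfolding dim_def B_def using B0 by auto
  ultimately show ?thesis using that B by blast
qed

definition basis :: "'v set \<Rightarrow> bool"
  where "basis B \<longleftrightarrow> finite B \<and> independent B \<and> span B = UNIV"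

lemma GL_extends_basis_bijection:
  assumes B: "basis B" and B': "basis B'" and f: "bij_betw f B B'"
  shows "\<exists>u\<in>GL. \<forall>b\<in>B. u b = f b"
proof -
  have fin: "finite B" "finite B'" and ind: "independent B" "independent B'"
    and sp: "span B = UNIV" "span B' = UNIV" using B B' by (auto simp: basis_def)
  have "\<exists>c. x = (\<Sum>b\<in>B. c b *s b)" for x using span_finite[OF fin(1)] sp by auto
  then obtain co where co: "x = (\<Sum>b\<in>B. co x b *s b)" for x by metis
  \<comment> \<open>The coordinates are pinned down only on \<open>B\<close>, which is all that \<open>u\<close> looks at.\<close>
  define u where "u x = (\<Sum>b\<in>B. co x b *s f b)" for x
  have u_comb: "u (\<Sum>b\<in>B. c b *s b) = (\<Sum>b\<in>B. c b *s f b)" for c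
    unfolding u_def using independent_unique[OF fin(1) ind(1) co[symmetric]]
    by (intro sum.cong) auto
  have add: "u (x + y) = u x + u y" for x y
  proof -
    have "u (x + y) = u (\<Sum>b\<in>B. (co x b + co y b) *s b)"
      using co[of x] co[of y] by (simp add: scale_left_distrib sum.distrib)
    also have "\<dots> = u x + u y"
      unfolding u_comb by (simp add: u_def scale_left_distrib sum.distrib)
    finally show ?thesis .
  qed
  have scale: "u (a *s x) = a *s u x" for a x
  proof -
    have "u (a *s x) = u (\<Sum>b\<in>B. (a * co x b) *s b)"
      by (subst co[of x]) (simp add: scale_sum_right scale_scale)
    also have "\<dots> = a *s u x"
      unfolding u_comb by (simp add: u_def scale_sum_right scale_scale)
    finally show ?thesis .
  qed
  have reindex: "(\<Sum>b\<in>B. c (f b) *s f b) = (\<Sum>b\<in>B'. c b *s b)" for c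
    using sum.reindex_bij_betw[OF f, of "\<lambda>b. c b *s b"] by simp
  have ker: "x = 0" if "u x = 0" for x
  proof -
    let ?h = "inv_into B f"
    have "?h (f b) = b" if "b \<in> B" for b using that f by (simp add: bij_betw_inv_into_left)
    then have "(\<Sum>b\<in>B. co x (?h (f b)) *s f b) = 0" using that by (simp add: u_def)
    then have "(\<Sum>b\<in>B'. co x (?h b) *s b) = 0"
      using reindex[of "\<lambda>b. co x (?h b)"] by simp
    then have "\<forall>b\<in>B'. co x (?h b) = 0"
      using independent_unique[OF fin(2) ind(2), of "\<lambda>b. co x (?h b)" "\<lambda>b. 0"] by simp
    then have "\<forall>b\<in>B. co x b = 0" using f bij_betw_inv_into_left bij_betwE by metis
    then show ?thesis using co[of x] by simp
  qed
  have "inj u"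
  proof (rule injI)
    fix x y assume "u x = u y"
    then have "u (x - y) = 0" using add[of "x - y" y] by simp
    then show "x = y" using ker by fastforce
  qed
  moreover have "surj u"
  proof -
    have "y \<in> range u" for y
    proof -
      have "y \<in> span B'" using sp by simp
      then obtain d where "y = (\<Sum>b\<in>B'. d b *s b)" unfolding span_finite[OF fin(2)] by blast
      then have "y = u (\<Sum>b\<in>B. d (f b) *s b)" by (simp add: u_comb reindex)
      then show ?thesis by blast
    qed
    then show ?thesis by blast
  qed
  ultimately have "u \<in> GL" using add scale by (auto simp: GL_def bij_def)
  moreover have "u b = f b" if "b \<in> B" for b
  proof -
    have "u (\<Sum>v\<in>B. (if v = b then 1 else 0) *s v) = (\<Sum>v\<in>B. (if v = b then 1 else 0) *s f v)"
      by (rule u_comb)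
    moreover have "(\<Sum>v\<in>B. (if v = b then 1 else 0) *s h v) = h b" for h
    proof -
      have "(\<Sum>v\<in>B. (if v = b then 1 else 0) *s h v) = (\<Sum>v\<in>B. if v = b then h v else 0)"
        by (intro sum.cong) (auto simp: scale_one)
      then show ?thesis using that fin by simp
    qed
    ultimately show ?thesis by simp
  qed
  ultimately show ?thesis by blast
qed

context
  assumes fin_dim: "finite_dim UNIV"
begin

lemma basis_card:
  assumes "basis B" shows "card B = dim UNIV"
proof -
  obtain C where C: "finite C" "independent C" "span C = span UNIV" "card C = dim UNIV"
    using finite_dim_obtain_basis[OF fin_dim] by blast
  have "span UNIV = UNIV" using span_base by blast
  then show ?thesis
    using independent_card_le[of C B] independent_card_le[of B C] C assms by (auto simp: basis_def)
qed

lemma exists_outside_span: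
  assumes "finite S" "card S < dim UNIV"
  shows "\<exists>z. z \<notin> span S"
proof (rule ccontr)
  assume "\<not> ?thesis"
  obtain C where "independent C" "card C = dim UNIV"
    using finite_dim_obtain_basis[OF fin_dim] by blast
  with independent_card_le[of S C] \<open>\<not> ?thesis\<close> assms show False by auto
qed

lemma extend_to_basis:
  assumes "independent S"
  obtains B where "basis B" "S \<subseteq> B"
proof -
  obtain C where C: "finite C" "independent C" "span C = span UNIV" "card C = dim UNIV"
    using finite_dim_obtain_basis[OF fin_dim] by blast
  have U: "span UNIV = UNIV" using span_base by blast
  have "finite S" using independent_card_le[of C S] C U assms by auto
  then obtain B where B: "finite B" "card B = card C" "S \<subseteq> B" "span C \<subseteq> span B"
    using exchange[of S C] C U assms by auto
  \<comment> \<open>A redundant vector in \<open>B\<close> would leave a spanning set smaller than the basis \<open>C\<close>.\<close>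
  have "independent B"
  proof
    assume "dependent B"
    then obtain t c v where t: "finite t" "t \<subseteq> B" "(\<Sum>v\<in>t. c v *s v) = 0" "v \<in> t" "c v \<noteq> 0"
      unfolding dependent_def by blast
    then have "c v *s v = (\<Sum>w\<in>t - {v}. (- c w) *s w)"
      by (simp add: sum_negf eq_neg_iff_add_eq_0 sum.remove)
    also have "\<dots> \<in> span (B - {v})"
      using t(2) by (intro subspace_sum[OF subspace_span] span_scale span_base) auto
    finally have "inverse (c v) *s (c v *s v) \<in> span (B - {v})" by (rule span_scale)
    then have "v \<in> span (B - {v})" using t by (simp add: scale_inverse)
    then have "B \<subseteq> span (B - {v})" by (auto intro: span_base)
    then have "span B \<subseteq> span (B - {v})" using span_subset_span by blast
    then have "C \<subseteq> span (B - {v})" using B C U by auto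
    then have "card C \<le> card (B - {v})" using independent_card_le[of "B - {v}" C] B C by auto
    moreover have "v \<in> B" using t by auto
    ultimately show False using B by (metis card_Diff1_less not_less)
  qed
  then show ?thesis using that B C U by (auto simp: basis_def)
qed

lemma GL_extends_injection:
  assumes "independent S" "independent (f ` S)" "inj_on f S"
  shows "\<exists>u\<in>GL. \<forall>b\<in>S. u b = f b"
proof -
  obtain B where B: "basis B" "S \<subseteq> B" using extend_to_basis assms by blast
  obtain B' where B': "basis B'" "f ` S \<subseteq> B'" using extend_to_basis assms by blast
  have fin: "finite B" "finite B'" "finite S" using B B' by (auto simp: basis_def intro: finite_subset)
  have "card (B - S) = card (B' - f ` S)"
    using B B' fin basis_card assms by (simp add: card_Diff_subset card_image)
  then obtain h where h: "bij_betw h (B - S) (B' - f ` S)"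
    using fin by (meson finite_Diff finite_same_card_bij)
  define k where "k b = (if b \<in> S then f b else h b)" for b
  have "bij_betw k S (f ` S)" using assms by (simp add: k_def bij_betw_def inj_on_def)
  moreover have "bij_betw k (B - S) (B' - f ` S)"
    using h by (rule bij_betw_cong[THEN iffD1, rotated]) (simp add: k_def)
  ultimately have "bij_betw k (S \<union> (B - S)) (f ` S \<union> (B' - f ` S))"
    by (rule bij_betw_combine) auto
  moreover have "S \<union> (B - S) = B" "f ` S \<union> (B' - f ` S) = B'" using B B' by auto
  ultimately obtain u where "u \<in> GL" "\<forall>b\<in>B. u b = k b"
    using GL_extends_basis_bijection[OF B(1) B'(1), of k] by auto
  then show ?thesis using B by (intro bexI[of _ u]) (auto simp: k_def)
qed

lemma transvection:
  assumes "independent B" "x \<in> B" "y \<in> B" "x \<noteq> y"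
  obtains u where "u \<in> GL" "u x = x + y" "\<And>b. b \<in> B - {x} \<Longrightarrow> u b = b"
proof -
  let ?f = "id(x := x + y)"
  have img: "?f ` B = insert (x + y) (B - {x})" using assms by auto
  have notin: "x + y \<notin> span (B - {x})"
    using independent_not_in_span[OF assms(1,2)] span_diff[of "x + y" "B - {x}" y] span_base[of y] assms
    by auto
  then have "independent (?f ` B)"
    unfolding img using assms(1) independent_mono[of B] by (intro independent_insert) auto
  moreover have "inj_on ?f B"
    using notin span_base by (fastforce simp: inj_on_def)
  ultimately obtain u where "u \<in> GL" "\<forall>b\<in>B. u b = ?f b"
    using GL_extends_injection assms by metis
  then show ?thesis using that[of u] assms by auto
qed

end

lemma GL_sum: "u \<in> GL \<Longrightarrow> u (\<Sum>i\<in>A. c i *s h i) = (\<Sum>i\<in>A. c i *s u (h i))"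
proof -
  assume u: "u \<in> GL"
  have "u (0 + 0) = u 0 + u 0" using u unfolding GL_def by blast
  then have "u 0 = 0" by simp
  then show ?thesis
    using u by (induction A rule: infinite_finite_induct) (auto simp: GL_def)
qed

lemma independent_singleton: "x \<noteq> 0 \<Longrightarrow> independent {x}"
  by (simp add: independent_finite)

lemma independent_pair: "x \<noteq> 0 \<Longrightarrow> y \<notin> span {x} \<Longrightarrow> independent {x, y}"
  using independent_insert[of "{x}" y] independent_singleton by (simp add: insert_commute)

lemma in_span_singleton: "y \<in> span {x} \<longleftrightarrow> (\<exists>a. y = a *s x)"
  by (auto simp: span_finite)

end

section \<open>Images of bases under a non-trivial GL-mapping\<close>

locale nontrivial_GL_mapping = left_vector_space_pair scale scale'
  for scale :: "'r::division_ring \<Rightarrow> 'v::ab_group_add \<Rightarrow> 'v" (infixr \<open>*s\<close> 75)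
    and scale' :: "'s::division_ring \<Rightarrow> 'w::ab_group_add \<Rightarrow> 'w" (infixr \<open>*t\<close> 75) +
  fixes g :: "'v \<Rightarrow> 'w"
  assumes GL_mapping: "GL_mapping g"
    and nontrivial: "nontrivial g"
    and finite_dim: "V.finite_dim UNIV"
    and dim_ge_2: "2 \<le> V.dim UNIV"
begin

lemma GL_companion:
  assumes "u \<in> V.GL"
  obtains u' where "u' \<in> V'.GL" "\<And>x. g (u x) = u' (g x)"
  using assms GL_mapping unfolding GL_mapping_def by (metis comp_apply)

lemma exists_outside_line: "\<exists>z. z \<notin> V.span {x}"
  using dim_ge_2 by (intro V.exists_outside_span[OF finite_dim]) auto

lemma exists_nonzero: "\<exists>x::'v. x \<noteq> 0"
proof -
  obtain z where "z \<notin> V.span {0}" using exists_outside_line by blast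
  then have "z \<noteq> 0" using V.span_zero by metis
  then show ?thesis by blast
qed

lemma GL_transitive_on_pairs:
  assumes "x \<noteq> 0" "y \<notin> V.span {x}" "v \<noteq> 0" "w \<notin> V.span {v}"
  obtains u where "u \<in> V.GL" "u x = v" "u y = w"
proof -
  let ?f = "\<lambda>z. if z = x then v else w"
  have "x \<noteq> y" "v \<noteq> w" using assms V.span_base by auto
  then have "?f ` {x, y} = {v, w}" "inj_on ?f {x, y}" by auto
  then obtain u where "u \<in> V.GL" "\<forall>b\<in>{x, y}. u b = ?f b"
    using V.GL_extends_injection[OF finite_dim, of "{x, y}" ?f] V.independent_pair assms by metis
  then show ?thesis using that[of u] \<open>x \<noteq> y\<close> by auto
qed

lemma GL_transitive:
  assumes "x \<noteq> 0" "v \<noteq> 0"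
  obtains u where "u \<in> V.GL" "u x = v"
  using GL_transitive_on_pairs[OF assms(1) _ assms(2)] exists_outside_line by metis

text \<open>
  A single coincidence on an independent pair spreads to all independent pairs by transitivity.
  Two nonzero vectors on a common line are then compared through a third vector off that line,
  so \<open>g\<close> would be constant off zero.
\<close>
lemma separates_lines:
  assumes "x \<noteq> 0" "y \<notin> V.span {x}"
  shows "g x \<noteq> g y"
proof
  assume eq: "g x = g y"
  have pair: "g v = g w" if "v \<noteq> 0" "w \<notin> V.span {v}" for v w
  proof -
    obtain u where u: "u \<in> V.GL" "u x = v" "u y = w"
      using GL_transitive_on_pairs[OF assms \<open>v \<noteq> 0\<close> \<open>w \<notin> V.span {v}\<close>] .
    obtain u' where "\<And>z. g (u z) = u' (g z)" using GL_companion[OF u(1)] by blast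
    from this[of x] this[of y] u eq show ?thesis by simp
  qed
  have "g v = g w" if "v \<noteq> 0" "w \<noteq> 0" for v w
  proof (cases "w \<in> V.span {v}")
    case True
    obtain z where z: "z \<notin> V.span {v}" using exists_outside_line by blast
    then have "z \<notin> V.span {w}" using V.span_subset_span[of "{w}" "{v}"] True by blast
    with z that pair show ?thesis by metis
  qed (use that pair in blast)
  with nontrivial \<open>x \<noteq> 0\<close> show False unfolding nontrivial_def by blast
qed

text \<open>
  Compare \<open>w\<close> with its image under the companion of the transvection \<open>b \<mapsto> b + b'\<close>: only the term
  at \<open>b\<close> changes, by \<open>c b (g (b + b') - g b)\<close>, and this difference of values is nonzero.
  The vector \<open>w\<close> ranges over \<open>V'\<close> rather than the image of \<open>g\<close>, so that \<open>w = 0\<close> is covered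
  before \<open>g 0 = 0\<close> is known.
\<close>
lemma coefficient_vanishes:
  assumes B: "V.basis B" "b \<in> B"
    and fixed: "\<And>u u'. u \<in> V.GL \<Longrightarrow> u' \<in> V'.GL \<Longrightarrow> (\<And>x. g (u x) = u' (g x)) \<Longrightarrow>
      (\<And>x. x \<in> B - {b} \<Longrightarrow> u x = x) \<Longrightarrow> u' w = w"
    and w: "w = (\<Sum>x\<in>B. c x *t g x)"
  shows "c b = 0"
proof -
  have fin: "finite B" and ind: "V.independent B" using B by (auto simp: V.basis_def)
  have "2 \<le> card B" using V.basis_card[OF finite_dim B(1)] dim_ge_2 by simp
  then have "B \<noteq> {b}" by auto
  then obtain b' where b': "b' \<in> B" "b \<noteq> b'" using B by blast
  obtain u where u: "u \<in> V.GL" "u b = b + b'" "\<And>x. x \<in> B - {b} \<Longrightarrow> u x = x"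
    using V.transvection[OF finite_dim ind B(2) b'] by blast
  obtain u' where u': "u' \<in> V'.GL" "\<And>x. g (u x) = u' (g x)" using GL_companion[OF u(1)] by blast
  have "(\<Sum>x\<in>B. c x *t g x) = u' w" using fixed[OF u(1) u' u(3)] w by simp
  also have "\<dots> = (\<Sum>x\<in>B. c x *t g (u x))" using V'.GL_sum[OF u'(1)] u'(2) w by simp
  also have "\<dots> = c b *t g (b + b') + (\<Sum>x\<in>B - {b}. c x *t g x)"
    using fin B u by (simp add: sum.remove)
  finally have "c b *t (g (b + b') - g b) = 0"
    using fin B by (simp add: sum.remove V'.scale_diff_right)
  moreover have "g (b + b') \<noteq> g b"
  proof -
    have "b \<noteq> 0" using V.independent_not_in_span[OF ind B(2)] V.span_zero by metis
    have "b' \<notin> V.span {b}"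
      using V.independent_not_in_span[OF ind b'(1)] V.span_mono[of "{b}" "B - {b'}"] B b' by auto
    then have "b + b' \<notin> V.span {b}"
      using V.span_diff[of "b + b'" "{b}" b] V.span_base[of b "{b}"] by auto
    with separates_lines[OF \<open>b \<noteq> 0\<close>] show ?thesis by metis
  qed
  ultimately show ?thesis by simp
qed

lemma basis_image:
  assumes B: "V.basis B"
  shows "inj_on g B" "V'.independent (g ` B)"
proof -
  have fin: "finite B" and ind: "V.independent B" using B by (auto simp: V.basis_def)
  show inj: "inj_on g B"
  proof (rule inj_onI, rule ccontr)
    fix x y assume xy: "x \<in> B" "y \<in> B" "g x = g y" "x \<noteq> y"
    then have "x \<noteq> 0" "y \<notin> V.span {x}"
      using V.independent_not_in_span[OF ind] V.span_zero V.span_mono[of "{x}" "B - {y}"] by auto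
    with separates_lines xy show False by blast
  qed
  have zero: "c b = 0" if "(\<Sum>x\<in>B. c x *t g x) = 0" "b \<in> B" for c b
  proof (rule coefficient_vanishes[OF B that(2)])
    show "0 = (\<Sum>x\<in>B. c x *t g x)" using that by simp
    show "u' 0 = 0" if "u' \<in> V'.GL" for u'
      using V'.GL_sum[OF that, of _ _ "{}"] by simp
  qed
  show "V'.independent (g ` B)"
    unfolding V'.independent_finite[OF finite_imageI[OF fin]] sum.reindex[OF inj] comp_def
    using zero[of "\<lambda>x. _ (g x)"] by blast
qed

lemma independent_image:
  assumes "V.independent S"
  shows "inj_on g S" "V'.independent (g ` S)"
proof -
  obtain B where "V.basis B" "S \<subseteq> B" using V.extend_to_basis[OF finite_dim assms] .
  with basis_image show "inj_on g S" "V'.independent (g ` S)"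
    using inj_on_subset V'.independent_mono[of "g ` B" "g ` S"] by blast+
qed

lemma nonzero_image:
  assumes "x \<noteq> 0" shows "g x \<noteq> 0"
  using independent_image(2)[OF V.independent_singleton[OF assms]]
    V'.independent_not_in_span[of "{g x}" "g x"] V'.span_zero by auto

end

section \<open>Semilinearity when the image spans a space of dimension at most n\<close>

locale small_image_GL_mapping = nontrivial_GL_mapping scale scale' g
  for scale :: "'r::division_ring \<Rightarrow> 'v::ab_group_add \<Rightarrow> 'v" (infixr \<open>*s\<close> 75)
    and scale' :: "'s::division_ring \<Rightarrow> 'w::ab_group_add \<Rightarrow> 'w" (infixr \<open>*t\<close> 75)
    and g :: "'v \<Rightarrow> 'w" +
  assumes dim_ge_3: "3 \<le> V.dim UNIV"
    and finite_dim_image: "V'.finite_dim (V'.span (range g))"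
    and dim_image: "V'.dim (V'.span (range g)) \<le> V.dim UNIV"
begin

text \<open>The \<open>n\<close> independent vectors \<open>g(B)\<close> lie in a space of dimension at most \<open>n\<close>, so they span it.\<close>
lemma span_basis_image:
  assumes B: "V.basis B"
  shows "g v \<in> V'.span (g ` B)"
proof -
  obtain T where T: "finite T" "V'.span T = V'.span (V'.span (range g))"
    "card T = V'.dim (V'.span (range g))"
    using V'.finite_dim_obtain_basis[OF finite_dim_image] by metis
  have range: "range g \<subseteq> V'.span T" unfolding T(2) by (auto intro: V'.span_base)
  have "card (g ` B) = V.dim UNIV"
    using card_image[OF basis_image(1)[OF B]] V.basis_card[OF finite_dim B] by simp
  then have "V'.span (g ` B) = V'.span T"
    using T range dim_image basis_image(2)[OF B]
    by (intro V'.independent_spans_if_card_ge) auto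
  with range show ?thesis by blast
qed

text \<open>
  Extend \<open>S\<close> to a basis. A transvection that moves only a basis vector \<open>b\<close> outside \<open>S\<close> fixes \<open>v\<close>,
  hence its companion fixes \<open>g v\<close>, and the coefficient of \<open>g v\<close> at \<open>b\<close> vanishes.
\<close>
lemma span_image:
  assumes S: "V.independent S" and v: "v \<in> V.span S"
  shows "g v \<in> V'.span (g ` S)"
proof -
  obtain B where B: "V.basis B" "S \<subseteq> B" using V.extend_to_basis[OF finite_dim S] .
  have fin: "finite B" using B by (simp add: V.basis_def)
  have "g v \<in> V'.span (g ` B)" using span_basis_image[OF B(1)] .
  then obtain d where "g v = (\<Sum>w\<in>g ` B. d w *t w)"
    unfolding V'.span_finite[OF finite_imageI[OF fin]] by blast
  then have c: "g v = (\<Sum>b\<in>B. d (g b) *t g b)"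
    using sum.reindex[OF basis_image(1)[OF B(1)]] by simp
  obtain t e where t: "t \<subseteq> S" "v = (\<Sum>x\<in>t. e x *s x)" using v unfolding V.span_def by blast
  have "d (g b) = 0" if b: "b \<in> B - S" for b
  proof (rule coefficient_vanishes[OF B(1) _ _ c])
    show "b \<in> B" using b by simp
    fix u u' assume u: "u \<in> V.GL" "\<And>x. g (u x) = u' (g x)" "\<And>x. x \<in> B - {b} \<Longrightarrow> u x = x"
    have "u v = (\<Sum>x\<in>t. e x *s u x)" unfolding t(2) by (rule V.GL_sum[OF u(1)])
    also have "\<dots> = v" unfolding t(2)
    proof (rule sum.cong)
      fix x assume "x \<in> t"
      then have "x \<in> B - {b}" using t(1) b B by auto
      then show "e x *s u x = e x *s x" using u(3) by simp
    qed simp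
    finally show "u' (g v) = g v" using u(2)[of v] by simp
  qed
  then have "g v = (\<Sum>b\<in>S. d (g b) *t g b)"
    unfolding c using B fin by (intro sum.mono_neutral_right) auto
  also have "\<dots> \<in> V'.span (g ` S)"
    by (intro V'.subspace_sum[OF V'.subspace_span] V'.span_scale V'.span_base) auto
  finally show ?thesis .
qed

lemma zero_image: "g 0 = 0"
  using span_image[of "{}" 0] V.span_zero by (simp add: V.independent_finite V'.span_finite)

text \<open>
  The coefficients found for one independent pair are valid for all of them by transitivity.
  Applying this to the exchanged pair makes the two coefficients equal, since
  \<open>(a - b) (g x - g y) = 0\<close> with \<open>g x \<noteq> g y\<close>.
\<close>
lemma additive_up_to_factor:
  "\<exists>a. \<forall>x y. x \<noteq> 0 \<longrightarrow> y \<notin> V.span {x} \<longrightarrow> g (x + y) = a *t (g x + g y)"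
proof -
  obtain x :: 'v where "x \<noteq> 0" using exists_nonzero by blast
  obtain y where y: "y \<notin> V.span {x}" using exists_outside_line by blast
  have "x \<noteq> y" using y V.span_base by auto
  have "g x \<noteq> g y" using separates_lines \<open>x \<noteq> 0\<close> y by blast
  have "x + y \<in> V.span {x, y}" by (intro V.span_add V.span_base) auto
  then have "g (x + y) \<in> V'.span (g ` {x, y})"
    using span_image V.independent_pair[OF \<open>x \<noteq> 0\<close> y] by blast
  then obtain c where "g (x + y) = (\<Sum>w\<in>{g x, g y}. c w *t w)"
    using V'.span_finite[of "g ` {x, y}"] by auto
  then obtain a b where ab: "g (x + y) = a *t g x + b *t g y" using \<open>g x \<noteq> g y\<close> by auto
  have all: "g (v + w) = a *t g v + b *t g w" if vw: "v \<noteq> 0" "w \<notin> V.span {v}" for v w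
  proof -
    obtain u where u: "u \<in> V.GL" "u x = v" "u y = w"
      using GL_transitive_on_pairs[OF \<open>x \<noteq> 0\<close> y vw] .
    obtain u' where u': "u' \<in> V'.GL" "\<And>x. g (u x) = u' (g x)" using GL_companion[OF u(1)] by blast
    have "g (v + w) = g (u (x + y))" using u by (simp add: V.GL_def)
    also have "\<dots> = a *t u' (g x) + b *t u' (g y)" using u' ab by (simp add: V'.GL_def)
    also have "\<dots> = a *t g v + b *t g w" using u u'(2)[of x] u'(2)[of y] by simp
    finally show ?thesis .
  qed
  have "y \<noteq> 0" using y V.span_zero by blast
  have "x \<notin> V.span {y}"
    using V.independent_not_in_span[OF V.independent_pair[OF \<open>x \<noteq> 0\<close> y], of x] \<open>x \<noteq> y\<close>
    by (simp add: insert_Diff_if)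
  then have "g (x + y) = a *t g y + b *t g x" using all[of y x] \<open>y \<noteq> 0\<close> by (simp add: add.commute)
  with ab have "(a - b) *t (g x - g y) = 0"
    by (simp add: V'.scale_diff_left V'.scale_diff_right algebra_simps)
  then have "a = b" using \<open>g x \<noteq> g y\<close> by simp
  with all show ?thesis by (auto simp: V'.scale_right_distrib)
qed

text \<open>
  With \<open>z\<close> outside the plane of \<open>x\<close> and \<open>y\<close>, bracketing \<open>x + y + z\<close> in two ways gives
  \<open>a g x + a\<^sup>2 g y + a\<^sup>2 g z = a\<^sup>2 g x + a\<^sup>2 g y + a g z\<close>, hence \<open>a = a\<^sup>2\<close>. The value \<open>a = 0\<close> is
  excluded because \<open>g\<close> does not vanish at \<open>x + y \<noteq> 0\<close>.
\<close>
lemma additive_on_independent: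
  assumes "x \<noteq> 0" "y \<notin> V.span {x}"
  shows "g (x + y) = g x + g y"
proof -
  obtain a where a: "\<And>x y. x \<noteq> 0 \<Longrightarrow> y \<notin> V.span {x} \<Longrightarrow> g (x + y) = a *t (g x + g y)"
    using additive_up_to_factor by blast
  have "card {x, y} < V.dim UNIV" using dim_ge_3 card_insert_le_m1[of 2 "{y}" x] by simp
  then obtain z where z: "z \<notin> V.span {x, y}" using V.exists_outside_span[OF finite_dim, of "{x, y}"] by auto
  have xy: "x \<in> V.span {x, y}" "y \<in> V.span {x, y}" by (auto intro: V.span_base)
  then have sub: "V.span {w} \<subseteq> V.span {x, y}" if "w \<in> {x, y, x + y}" for w
    using that V.span_add by (intro V.span_subset_span) auto
  have "x + y \<noteq> 0"
    using assms V.span_scale[of x "{x}" "- 1"] V.span_base[of x "{x}"]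
    by (auto simp: V.scale_one add_eq_0_iff)
  have "y \<noteq> 0" using assms V.span_zero by blast
  have "y + z \<notin> V.span {x}"
    using sub[of x] xy z V.span_diff[of "y + z" "{x, y}" y] by auto
  moreover have "z \<notin> V.span {y}" using sub[of y] z by auto
  ultimately have "g (x + (y + z)) = a *t (g x + a *t (g y + g z))"
    using a[OF \<open>x \<noteq> 0\<close>] a[OF \<open>y \<noteq> 0\<close>] by simp
  moreover have "g ((x + y) + z) = a *t (a *t (g x + g y) + g z)"
    using a[OF \<open>x + y \<noteq> 0\<close>, of z] a[OF assms] sub[of "x + y"] z by auto
  ultimately have "(a - a * a) *t (g x - g z) = 0"
    by (simp add: V'.scale_diff_left V'.scale_diff_right V'.scale_right_distrib V'.scale_scale
        algebra_simps)
  moreover have "g x \<noteq> g z" using separates_lines[OF \<open>x \<noteq> 0\<close>] sub[of x] z by auto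
  ultimately have "a * a = a * 1" by simp
  moreover have "a \<noteq> 0" using a[OF assms] nonzero_image[OF \<open>x + y \<noteq> 0\<close>] by auto
  ultimately have "a = 1" using mult_left_cancel by blast
  with a[OF assms] show ?thesis by (simp add: V'.scale_one)
qed

text \<open>
  For \<open>x, y\<close> on a common line, take \<open>z\<close> off that line: in \<open>x + (y + z) = (x + y) + z\<close> the pairs
  \<open>x, y + z\<close> and \<open>y, z\<close> are independent, and so is \<open>x + y, z\<close> unless \<open>x + y = 0\<close>, in which case
  the right-hand side is just \<open>z\<close>.
\<close>
lemma additive: "g (x + y) = g x + g y"
proof (cases "x = 0 \<or> y = 0 \<or> y \<notin> V.span {x}")
  case True
  then show ?thesis
    using additive_on_independent zero_image by (cases "x = 0 \<or> y = 0") auto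
next
  case False
  then have "x \<noteq> 0" "y \<noteq> 0" and y: "y \<in> V.span {x}" by auto
  obtain z where z: "z \<notin> V.span {x}" using exists_outside_line by blast
  have "x \<in> V.span {x}" by (simp add: V.span_base)
  then have sub: "V.span {w} \<subseteq> V.span {x}" if "w \<in> {y, x + y}" for w
    using that y V.span_add by (intro V.span_subset_span) auto
  have "y + z \<notin> V.span {x}" using y z V.span_diff[of "y + z" "{x}" y] by auto
  then have xyz: "g (x + y + z) = g x + g y + g z"
    using additive_on_independent[OF \<open>x \<noteq> 0\<close>, of "y + z"]
      additive_on_independent[OF \<open>y \<noteq> 0\<close>, of z] sub[of y] z by (auto simp: add.assoc)
  show ?thesis
  proof (cases "x + y = 0")
    case True
    with xyz zero_image show ?thesis by simp
  next
    case False
    moreover have "z \<notin> V.span {x + y}" using sub[of "x + y"] z by auto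
    ultimately have "g (x + y) + g z = g x + g y + g z"
      using additive_on_independent xyz by metis
    then show ?thesis by simp
  qed
qed

lemma injective: "inj g"
proof (rule injI)
  fix x y assume "g x = g y"
  then have "g (x - y) = 0" using additive[of "x - y" y] by simp
  then show "x = y" using nonzero_image[of "x - y"] by auto
qed

text \<open>
  The scalars \<open>\<sigma> a\<close> are read off at one nonzero vector \<open>x\<close> and transported to all others by
  transitivity. As \<open>g x \<noteq> 0\<close> can be cancelled, the module laws and the additivity of \<open>g\<close> make
  \<open>\<sigma>\<close> a ring homomorphism.
\<close>
lemma semilinear: "semilinear g"
proof -
  obtain x :: 'v where x: "x \<noteq> 0" using exists_nonzero by blast
  have "\<exists>s. g (a *s x) = s *t g x" for a
  proof -
    have "a *s x \<in> V.span {x}" by (intro V.span_scale V.span_base) simp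
    then show ?thesis
      using span_image[OF V.independent_singleton[OF x]] by (simp add: V'.in_span_singleton)
  qed
  then obtain \<sigma> where \<sigma>: "\<And>a. g (a *s x) = \<sigma> a *t g x" by metis
  have scale: "g (a *s v) = \<sigma> a *t g v" for a v
  proof (cases "v = 0")
    case True
    then show ?thesis using zero_image by simp
  next
    case False
    obtain u where u: "u \<in> V.GL" "u x = v" using GL_transitive[OF x False] .
    obtain u' where u': "u' \<in> V'.GL" "\<And>x. g (u x) = u' (g x)" using GL_companion[OF u(1)] by blast
    have "g (a *s v) = u' (g (a *s x))" using u u'(2)[of "a *s x"] by (simp add: V.GL_def)
    also have "\<dots> = \<sigma> a *t g v" using \<sigma> u u' by (simp add: V'.GL_def flip: u'(2))
    finally show ?thesis .
  qed
  have cancel: "s = t" if "s *t g x = t *t g x" for s t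
  proof -
    have "(s - t) *t g x = 0" using that by (simp add: V'.scale_diff_left)
    then show ?thesis using nonzero_image[OF x] by simp
  qed
  have "ring_homomorphism \<sigma>"
    unfolding ring_homomorphism_def
  proof (intro conjI allI)
    show "\<sigma> 1 = 1" by (rule cancel) (simp add: V.scale_one V'.scale_one flip: scale)
    show "\<sigma> (a + b) = \<sigma> a + \<sigma> b" for a b
      by (rule cancel) (simp add: V.scale_left_distrib V'.scale_left_distrib additive flip: scale)
    show "\<sigma> (a * b) = \<sigma> a * \<sigma> b" for a b
      by (rule cancel) (simp flip: scale V.scale_scale V'.scale_scale)
  qed
  with additive scale show ?thesis unfolding semilinear_def by blast
qed

lemma strong: "strong_semilinear_embedding g"
  unfolding strong_semilinear_embedding_def
  using semilinear injective independent_image(2) by blast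

end

theorem theorem1:
  fixes scale :: "'r::division_ring \<Rightarrow> 'v::ab_group_add \<Rightarrow> 'v"
    and scale' :: "'s::division_ring \<Rightarrow> 'w::ab_group_add \<Rightarrow> 'w"
    and g :: "'v \<Rightarrow> 'w"
    and n :: nat
  assumes "left_vector_space scale"
    and "left_vector_space scale'"
    and "left_vector_space.finite_dim scale UNIV"
    and "left_vector_space.dim scale UNIV = n"
    and "n \<ge> 3"
    and "left_vector_space_pair.GL_mapping scale scale' g"
    and "nontrivial g"
    and "left_vector_space.finite_dim scale' (left_vector_space.span scale' (range g))"
    and "left_vector_space.dim scale' (left_vector_space.span scale' (range g)) \<le> n"
  shows "left_vector_space_pair.strong_semilinear_embedding scale scale' g"
proof -
  interpret V: left_vector_space scale by fact
  interpret V': left_vector_space scale' by fact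
  interpret left_vector_space_pair scale scale' by unfold_locales
  interpret small_image_GL_mapping scale scale' g
    using assms by unfold_locales auto
  show ?thesis by (rule strong)
qed

end
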